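(* For every integer $n\ge 1$, $$\mathcal{CS}_+^{n*}=\bigcap_{r\ge 1}\mathcal D^n_r .$$
   Context: $\mathcal S^n$ is the space of real symmetric $n\times n$ matrices with trace inner product $\langle X,Y\rangle=\mathrm{Tr}(XY)$ ($\mathrm{Tr}$ is the usual, non-normalized trace), and $\mathcal S^d_+\subseteq \mathcal S^d$ is the cone of positive semidefinite matrices. The completely positive semidefinite cone $\mathcal{CS}_+^n$ is the set of $A\in\mathcal S^n$ of the form $A=(\langle X_i,X_j\rangle)_{i,j=1}^n$ for some $d\ge1$ and some $X_1,\dots,X_n\in\mathcal S^d_+$. Its dual cone is $\mathcal{CS}_+^{n*}=\{M\in\mathcal S^n:\langle A,M\rangle\ge 0\ \forall A\in\mathcal{CS}_+^n\}$. For $M\in\mathcal S^n$ and an $n$-tuple $\underline X=(X_1,\dots,X_n)$ of real symmetric matrices of the same size, $p_M(\underline X)=\sum_{i,j=1}^n M_{ij}X_iX_j$. Let $\mathbf\Delta_n=\{\underline X=(X_1,\dots,X_n)\in\bigcup_{d\ge1}(\mathcal S^d_+)^n:\sum_{i=1}^n\mathrm{Tr}(X_i)=1\}$. For an integer $r\ge1$, let $\mathbf\Delta(n,r)$ be the set of $\underline X\in\mathbf\Delta_n$ such that all entries of each $X_i$ are rational with denominator at most $r$ (i.e. each entry can be written as $p/q$ with $p,q\in\mathbb Z$, $1\le q\le r$), and let $$\mathcal D^n_r=\{M\in\mathcal S^n:\mathrm{Tr}(p_M(\underline X))\ge0\ \ \forall\,\underline X\in\mathbf\Delta(n,r)\}.$$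 *)

theory Defs
  imports "Jordan_Normal_Form.Matrix" Complex_Main
begin

text \<open>The matrix size \<open>d\<close> is existentially quantified below, so matrices are elements of
  \<open>carrier_mat d d\<close>, not of a type indexed by its dimension. Indices run over
  \<open>0, \<dots>, n - 1\<close>, and an \<open>n\<close>-tuple of matrices is a list of length \<open>n\<close>.\<close>

definition sym_mats :: "nat \<Rightarrow> real mat set" where
  "sym_mats d = {X \<in> carrier_mat d d. transpose_mat X = X}"

definition psd_mats :: "nat \<Rightarrow> real mat set" where
  "psd_mats d = {X \<in> sym_mats d. \<forall>v \<in> carrier_vec d. 0 \<le> v \<bullet> (X *\<^sub>v v)}"

definition mat_trace :: "real mat \<Rightarrow> real" where
  "mat_trace X = (\<Sum>i<dim_row X. X $$ (i, i))"

definition mat_inner :: "real mat \<Rightarrow> real mat \<Rightarrow> real" where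
  "mat_inner X Y = mat_trace (X * Y)"

definition cs_plus :: "nat \<Rightarrow> real mat set" where
  "cs_plus n = {A \<in> sym_mats n. \<exists>d\<ge>1. \<exists>Xs. length Xs = n \<and> set Xs \<subseteq> psd_mats d \<and>
     A = mat n n (\<lambda>(i, j). mat_inner (Xs ! i) (Xs ! j))}"

definition dual_cone :: "nat \<Rightarrow> real mat set \<Rightarrow> real mat set" where
  "dual_cone n K = {M \<in> sym_mats n. \<forall>A \<in> K. 0 \<le> mat_inner A M}"

text \<open>The value \<open>p_M(X_1, \<dots>, X_n)\<close>, again a matrix. The common size of the \<open>X_i\<close> is read off the
  first one, so this is only meaningful for a nonempty tuple. JNF matrices of varying size are not
  in \<open>comm_monoid_add\<close>, hence the sum in the additive group of \<open>d \<times> d\<close> matrices.\<close>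

definition p_eval :: "real mat \<Rightarrow> real mat list \<Rightarrow> real mat" where
  "p_eval M Xs = (let n = length Xs; d = dim_row (hd Xs) in
     finsum (module_mat TYPE(real) d d)
       (\<lambda>(i, j). M $$ (i, j) \<cdot>\<^sub>m (Xs ! i * Xs ! j)) ({..<n} \<times> {..<n}))"

lemma index_finsum_mat:
  assumes "finite F" and "\<And>x. x \<in> F \<Longrightarrow> f x \<in> carrier_mat d d" and "k < d" "l < d"
  shows "finsum (module_mat TYPE(real) d d) f F $$ (k, l) = (\<Sum>x\<in>F. f x $$ (k, l))"
    and "finsum (module_mat TYPE(real) d d) f F \<in> carrier_mat d d"
proof -
  interpret abelian_group "module_mat TYPE(real) d d" by (rule abelian_group_mat)
  have "finsum (module_mat TYPE(real) d d) f F \<in> carrier_mat d d \<and>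
    finsum (module_mat TYPE(real) d d) f F $$ (k, l) = (\<Sum>x\<in>F. f x $$ (k, l))"
    using assms(1,2)
  proof (induction F rule: finite_induct)
    case empty
    then show ?case using assms(3,4) by (simp add: module_mat_simps finsum_empty)
  next
    case (insert x F)
    have "f \<in> F \<rightarrow> carrier (module_mat TYPE(real) d d)" "f x \<in> carrier (module_mat TYPE(real) d d)"
      using insert.prems by (auto simp: module_mat_simps)
    moreover have "(f x + finsum (module_mat TYPE(real) d d) f F) $$ (k, l) =
      f x $$ (k, l) + finsum (module_mat TYPE(real) d d) f F $$ (k, l)"
    proof (rule index_add_mat(1))
      have "finsum (module_mat TYPE(real) d d) f F \<in> carrier_mat d d"
        using insert.IH insert.prems by blast
      then show "k < dim_row (finsum (module_mat TYPE(real) d d) f F)"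
        and "l < dim_col (finsum (module_mat TYPE(real) d d) f F)"
        using assms(3,4) by auto
    qed
    ultimately show ?case using insert by (simp add: finsum_insert module_mat_simps)
  qed
  then show "finsum (module_mat TYPE(real) d d) f F $$ (k, l) = (\<Sum>x\<in>F. f x $$ (k, l))"
    and "finsum (module_mat TYPE(real) d d) f F \<in> carrier_mat d d" by auto
qed

lemma p_eval_index:
  assumes X: "set Xs \<subseteq> carrier_mat d d" and "Xs \<noteq> []" and kl: "k < d" "l < d"
  shows "p_eval M Xs $$ (k, l) =
    (\<Sum>i<length Xs. \<Sum>j<length Xs. M $$ (i, j) * (Xs ! i * Xs ! j) $$ (k, l))"
proof -
  have d: "dim_row (hd Xs) = d" using X hd_in_set[OF \<open>Xs \<noteq> []\<close>] by auto
  have c: "Xs ! i \<in> carrier_mat d d" if "i < length Xs" for i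
    using X nth_mem[OF that] by blast
  have m: "M $$ (i, j) \<cdot>\<^sub>m (Xs ! i * Xs ! j) \<in> carrier_mat d d"
    if "i < length Xs" "j < length Xs" for i j
    using mult_carrier_mat[OF c[OF that(1)] c[OF that(2)]] by (simp add: smult_carrier_mat)
  have "p_eval M Xs $$ (k, l) = (\<Sum>x\<in>{..<length Xs} \<times> {..<length Xs}.
     (case x of (i, j) \<Rightarrow> M $$ (i, j) \<cdot>\<^sub>m (Xs ! i * Xs ! j)) $$ (k, l))"
    unfolding p_eval_def Let_def d
    by (rule index_finsum_mat(1)) (use kl m in \<open>auto simp del: smult_carrier_mat\<close>)
  also have "\<dots> = (\<Sum>(i, j)\<in>{..<length Xs} \<times> {..<length Xs}.
     M $$ (i, j) * (Xs ! i * Xs ! j) $$ (k, l))"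
    using kl by (intro sum.cong) (auto dest!: c)
  finally show ?thesis by (simp add: sum.cartesian_product)
qed

definition Delta :: "nat \<Rightarrow> real mat list set" where
  "Delta n = {Xs. length Xs = n \<and> (\<exists>d\<ge>1. set Xs \<subseteq> psd_mats d) \<and>
     (\<Sum>i<n. mat_trace (Xs ! i)) = 1}"

definition rat_denom_le :: "nat \<Rightarrow> real \<Rightarrow> bool" where
  "rat_denom_le r x \<longleftrightarrow> (\<exists>p q :: int. 1 \<le> q \<and> q \<le> int r \<and> x = of_int p / of_int q)"

definition Delta_rat :: "nat \<Rightarrow> nat \<Rightarrow> real mat list set" where
  "Delta_rat n r = {Xs \<in> Delta n. \<forall>X \<in> set Xs. \<forall>k < dim_row X. \<forall>l < dim_col X.
     rat_denom_le r (X $$ (k, l))}"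

definition D_cone :: "nat \<Rightarrow> nat \<Rightarrow> real mat set" where
  "D_cone n r = {M \<in> sym_mats n. \<forall>Xs \<in> Delta_rat n r. 0 \<le> mat_trace (p_eval M Xs)}"

end

(* The inclusion from left to right rewrites Tr p_M(X) as <A, M> for the Gram matrix A of X.
   Conversely, given psd matrices X_i of size d and m >= 1, round m X_i entrywise down and add
   (d + 1) I. A symmetric error with entries in [-1, 0] has operator norm at most d, so the resulting
   integer matrices Z_i are psd, and the sum t of their traces is a positive integer. Hence (Z_i / t)
   lies in Delta(n, t), and M in D_t gives the inequality for Z by homogeneity. Since Z_i / m
   tends to X_i, it holds for X in the limit. *)
theory Submission
  imports Defs
begin

text \<open>The common value of the two quantities to be compared, \<open>Tr p_M(X)\<close> and the
  pairing of \<open>M\<close> with the Gram matrix of \<open>Xs\<close>. As a plain double sum of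
  reals it avoids \<open>finsum\<close> and is visibly quadratic in \<open>Xs\<close>.\<close>

definition gram_form :: "real mat \<Rightarrow> real mat list \<Rightarrow> real" where
  "gram_form M Xs = (\<Sum>i<length Xs. \<Sum>j<length Xs. M $$ (i, j) * mat_inner (Xs ! i) (Xs ! j))"

lemma mat_inner_sum:
  assumes "X \<in> carrier_mat d e" "Y \<in> carrier_mat e d"
  shows "mat_inner X Y = (\<Sum>k<d. \<Sum>l<e. X $$ (k, l) * Y $$ (l, k))"
  using assms by (simp add: mat_inner_def mat_trace_def scalar_prod_def atLeast0LessThan)

lemma mat_inner_commute:
  assumes "X \<in> carrier_mat d e" "Y \<in> carrier_mat e d"
  shows "mat_inner X Y = mat_inner Y X"
  unfolding mat_inner_sum[OF assms] mat_inner_sum[OF assms(2,1)]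
  by (subst sum.swap) (simp add: mult.commute)

lemma mat_inner_smult:
  assumes "X \<in> carrier_mat d e" "Y \<in> carrier_mat e d"
  shows "mat_inner (a \<cdot>\<^sub>m X) (b \<cdot>\<^sub>m Y) = a * b * mat_inner X Y"
  using assms by (simp add: mat_inner_sum[where d = d and e = e] sum_distrib_left mult_ac)

lemma gram_form_smult:
  assumes "set Xs \<subseteq> carrier_mat d d"
  shows "gram_form M (map ((\<cdot>\<^sub>m) c) Xs) = c\<^sup>2 * gram_form M Xs"
proof -
  have "Xs ! i \<in> carrier_mat d d" if "i < length Xs" for i
    using assms nth_mem[OF that] by blast
  then show ?thesis
    by (simp add: gram_form_def mat_inner_smult[where d = d and e = d] sum_distrib_left
        power2_eq_square mult_ac)
qed

lemma sym_mats_index: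
  assumes "X \<in> sym_mats d" "k < d" "l < d"
  shows "X $$ (k, l) = X $$ (l, k)"
proof -
  have X: "X \<in> carrier_mat d d" "transpose_mat X = X" using assms by (auto simp: sym_mats_def)
  have "transpose_mat X $$ (k, l) = X $$ (l, k)" using X(1) assms by simp
  then show ?thesis by (simp only: X(2))
qed

lemma sym_matsI:
  assumes "X \<in> carrier_mat d d" "\<And>k l. k < d \<Longrightarrow> l < d \<Longrightarrow> X $$ (k, l) = X $$ (l, k)"
  shows "X \<in> sym_mats d"
  using assms by (auto simp: sym_mats_def intro!: eq_matI)

lemma psd_mats_carrier: "psd_mats d \<subseteq> carrier_mat d d"
  by (auto simp: psd_mats_def sym_mats_def)

lemma quadratic_form_sum:
  assumes "X \<in> carrier_mat d d" "v \<in> carrier_vec d"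
  shows "v \<bullet> (X *\<^sub>v v) = (\<Sum>k<d. \<Sum>l<d. v $ k * X $$ (k, l) * v $ l)"
  using assms by (simp add: scalar_prod_def atLeast0LessThan sum_distrib_left mult_ac)

lemma psd_mats_smult:
  fixes c :: real
  assumes "X \<in> psd_mats d" "0 \<le> c"
  shows "c \<cdot>\<^sub>m X \<in> psd_mats d"
proof -
  have X: "X \<in> carrier_mat d d" using assms psd_mats_carrier by blast
  have "c \<cdot>\<^sub>m X \<in> sym_mats d"
    using assms X by (intro sym_matsI) (auto simp: psd_mats_def sym_mats_index[of X d])
  moreover have "v \<bullet> (c \<cdot>\<^sub>m X *\<^sub>v v) = c * (v \<bullet> (X *\<^sub>v v))" if "v \<in> carrier_vec d" for v
    using X that by (simp add: quadratic_form_sum[where d = d] sum_distrib_left mult_ac)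
  ultimately show ?thesis using assms by (auto simp: psd_mats_def)
qed

text \<open>Write \<open>Z = X + c I + E\<close> with all entries of \<open>E\<close> at most 1 in
  absolute value. Then \<open>v_k E_kl v_l\<close> is at least \<open>-(v_k^2 + v_l^2) / 2\<close>,
  so summing over \<open>k\<close> and \<open>l\<close> bounds the form of \<open>E\<close> below by
  \<open>-d |v|^2\<close>, which the term \<open>c |v|^2\<close> absorbs. No eigenvalues are
  involved.\<close>

lemma psd_mats_perturb:
  assumes X: "X \<in> psd_mats d" and Z: "Z \<in> sym_mats d" and c: "real d \<le> c"
    and le: "\<And>k l. k < d \<Longrightarrow> l < d \<Longrightarrow> \<bar>Z $$ (k, l) - X $$ (k, l) - (if k = l then c else 0)\<bar> \<le> 1"
  shows "Z \<in> psd_mats d"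
proof -
  have "0 \<le> v \<bullet> (Z *\<^sub>v v)" if v: "v \<in> carrier_vec d" for v
  proof -
    define E where "E k l = Z $$ (k, l) - X $$ (k, l) - (if k = l then c else 0)" for k l
    define s where "s = (\<Sum>k<d. (v $ k)\<^sup>2)"
    have s: "0 \<le> s" by (simp add: s_def sum_nonneg)
    have "- ((v $ k)\<^sup>2 + (v $ l)\<^sup>2) / 2 \<le> v $ k * E k l * v $ l" if "k < d" "l < d" for k l
    proof -
      have "\<bar>v $ k * E k l * v $ l\<bar> = \<bar>E k l\<bar> * \<bar>v $ k * v $ l\<bar>" by (simp add: abs_mult)
      also have "\<dots> \<le> 1 * \<bar>v $ k * v $ l\<bar>"
        using le[OF that] by (intro mult_right_mono) (auto simp: E_def)
      finally have "\<bar>v $ k * E k l * v $ l\<bar> \<le> \<bar>v $ k * v $ l\<bar>" by simp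
      moreover have "2 * \<bar>v $ k * v $ l\<bar> \<le> (v $ k)\<^sup>2 + (v $ l)\<^sup>2"
        using sum_squares_bound[of "\<bar>v $ k\<bar>" "\<bar>v $ l\<bar>"] by (simp add: abs_mult)
      \<comment> \<open>Here \<open>a\<close>, \<open>b\<close>, \<open>c\<close> are fresh reals,
        this \<open>c\<close> not being the shift: the products above become atoms of a linear
        problem.\<close>
      moreover have "- c / 2 \<le> a" if "\<bar>a\<bar> \<le> b" "2 * b \<le> c" for a b c :: real
        using that by linarith
      ultimately show ?thesis by blast
    qed
    then have "(\<Sum>k<d. \<Sum>l<d. - ((v $ k)\<^sup>2 + (v $ l)\<^sup>2) / 2) \<le> (\<Sum>k<d. \<Sum>l<d. v $ k * E k l * v $ l)"
      by (intro sum_mono) auto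
    \<comment> \<open>Each square occurs \<open>d\<close> times as the first summand and
      \<open>d\<close> times as the second, which cancels the factor 1/2.\<close>
    moreover have "(\<Sum>k<d. \<Sum>l<d. - ((v $ k)\<^sup>2 + (v $ l)\<^sup>2) / 2) = - (real d * s)"
      by (simp add: s_def sum_negf sum_subtractf sum_distrib_left[symmetric]
          flip: sum_divide_distrib)
    moreover have "v \<bullet> (Z *\<^sub>v v) = v \<bullet> (X *\<^sub>v v) + (\<Sum>k<d. \<Sum>l<d. v $ k * E k l * v $ l) + c * s"
    proof -
      have "v $ k * Z $$ (k, l) * v $ l = v $ k * X $$ (k, l) * v $ l + v $ k * E k l * v $ l
          + (if k = l then c * (v $ k)\<^sup>2 else 0)" for k l
        by (simp add: E_def algebra_simps power2_eq_square)
      moreover have "Z \<in> carrier_mat d d" "X \<in> carrier_mat d d"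
        using X Z by (auto simp: psd_mats_def sym_mats_def)
      ultimately show ?thesis
        using v by (simp add: quadratic_form_sum sum.distrib s_def sum_distrib_left)
    qed
    moreover have "0 \<le> v \<bullet> (X *\<^sub>v v)" using X v by (simp add: psd_mats_def)
    moreover have "real d * s \<le> c * s" using c s by (rule mult_right_mono)
    ultimately show ?thesis by linarith
  qed
  then show ?thesis using Z by (simp add: psd_mats_def)
qed

lemma psd_mats_diag_nonneg:
  assumes "X \<in> psd_mats d" "k < d"
  shows "0 \<le> X $$ (k, k)"
proof -
  have X: "X \<in> carrier_mat d d" using assms psd_mats_carrier by blast
  have "0 \<le> unit_vec d k \<bullet> (X *\<^sub>v unit_vec d k)" using assms by (simp add: psd_mats_def)
  also have "\<dots> = X $$ (k, k)" using X assms(2) by simp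
  finally show ?thesis .
qed

lemma trace_p_eval:
  assumes Xs: "set Xs \<subseteq> carrier_mat d d" "Xs \<noteq> []" and d: "1 \<le> d"
  shows "mat_trace (p_eval M Xs) = gram_form M Xs"
proof -
  have c: "Xs ! i \<in> carrier_mat d d" if "i < length Xs" for i
    using Xs nth_mem[OF that] by blast
  have hd: "dim_row (hd Xs) = d" using Xs hd_in_set by fastforce
  have "p_eval M Xs \<in> carrier_mat d d"
    unfolding p_eval_def Let_def hd
    \<comment> \<open>\<open>index_finsum_mat\<close> assumes valid indices \<open>k\<close> and
      \<open>l\<close> even for its carrier claim; index 0 is valid because
      \<open>1 \<le> d\<close>.\<close>
    by (rule index_finsum_mat(2)[where k = 0 and l = 0])
      (use d c in \<open>auto intro!: smult_carrier_mat mult_carrier_mat\<close>)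
  then have "mat_trace (p_eval M Xs) =
      (\<Sum>k<d. \<Sum>i<length Xs. \<Sum>j<length Xs. M $$ (i, j) * (Xs ! i * Xs ! j) $$ (k, k))"
    by (simp add: mat_trace_def p_eval_index[OF Xs])
  also have "\<dots> = (\<Sum>i<length Xs. \<Sum>j<length Xs. \<Sum>k<d. M $$ (i, j) * (Xs ! i * Xs ! j) $$ (k, k))"
    by (subst sum.swap, rule sum.cong[OF refl], rule sum.swap)
  also have "\<dots> = gram_form M Xs"
    unfolding gram_form_def
    by (intro sum.cong refl) (use c in \<open>auto simp: mat_inner_def mat_trace_def sum_distrib_left\<close>)
  finally show ?thesis .
qed

text \<open>The trace of the product pairs entry (i, j) of the Gram matrix with entry (j, i) of
  \<open>M\<close>; the symmetry of \<open>M\<close> exchanges the indices.\<close>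

lemma mat_inner_gram:
  assumes "M \<in> sym_mats (length Xs)"
  shows "mat_inner (mat (length Xs) (length Xs) (\<lambda>(i, j). mat_inner (Xs ! i) (Xs ! j))) M = gram_form M Xs"
proof -
  have "M \<in> carrier_mat (length Xs) (length Xs)" using assms by (simp add: sym_mats_def)
  then show ?thesis
    unfolding gram_form_def
    by (subst mat_inner_sum[where d = "length Xs" and e = "length Xs"])
      (auto intro!: sum.cong simp: sym_mats_index[OF assms])
qed

lemma dual_cone_cs_plus_iff:
  "M \<in> dual_cone n (cs_plus n) \<longleftrightarrow> M \<in> sym_mats n \<and>
    (\<forall>d\<ge>1. \<forall>Xs. length Xs = n \<longrightarrow> set Xs \<subseteq> psd_mats d \<longrightarrow> 0 \<le> gram_form M Xs)"
proof -
  define G where "G Xs = mat n n (\<lambda>(i, j). mat_inner (Xs ! i) (Xs ! j))" for Xs :: "real mat list"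
  \<comment> \<open>By \<open>Tr(XY) = Tr(YX)\<close>, so every tuple of psd matrices of a common
    size contributes its Gram matrix to \<open>cs_plus n\<close>.\<close>
  have "G Xs \<in> sym_mats n"
    if "length Xs = n" "set Xs \<subseteq> psd_mats d" for Xs d
  proof -
    have "Xs ! i \<in> carrier_mat d d" if "i < n" for i
      using that \<open>length Xs = n\<close> \<open>set Xs \<subseteq> psd_mats d\<close> psd_mats_carrier nth_mem by blast
    then show ?thesis by (intro sym_matsI) (auto simp: G_def intro: mat_inner_commute)
  qed
  then have "cs_plus n = {G Xs | Xs. length Xs = n \<and> (\<exists>d\<ge>1. set Xs \<subseteq> psd_mats d)}"
    unfolding cs_plus_def G_def[symmetric] by blast
  moreover have "mat_inner (G Xs) M = gram_form M Xs" if "M \<in> sym_mats n" "length Xs = n" for Xs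
    using mat_inner_gram[of M Xs] that by (simp add: G_def)
  ultimately have "M \<in> dual_cone n (cs_plus n) \<longleftrightarrow> M \<in> sym_mats n \<and>
      (\<forall>Xs. length Xs = n \<and> (\<exists>d\<ge>1. set Xs \<subseteq> psd_mats d) \<longrightarrow> 0 \<le> gram_form M Xs)"
    unfolding dual_cone_def by fastforce
  then show ?thesis by blast
qed

text \<open>The diagonal shift \<open>d + 1\<close> exceeds the \<open>d\<close> that pays for the
  rounding errors, and it makes the diagonal positive when \<open>X\<close> is psd. It does not
  depend on \<open>m\<close>, so it disappears in the limit after division by
  \<open>m\<close>.\<close>

definition round_mat :: "nat \<Rightarrow> nat \<Rightarrow> real mat \<Rightarrow> real mat" where
  "round_mat d m X = mat d d (\<lambda>(k, l). of_int
     (\<lfloor>real m * X $$ (k, l)\<rfloor> + (if k = l then int d + 1 else 0)))"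

lemma round_mat_carrier [simp]: "round_mat d m X \<in> carrier_mat d d"
  by (simp add: round_mat_def)

lemma round_mat_psd:
  assumes "X \<in> psd_mats d"
  shows "round_mat d m X \<in> psd_mats d"
proof (rule psd_mats_perturb)
  show "real m \<cdot>\<^sub>m X \<in> psd_mats d" using assms by (simp add: psd_mats_smult)
  have X: "X \<in> carrier_mat d d" using assms psd_mats_carrier by blast
  have "X $$ (k, l) = X $$ (l, k)" if "k < d" "l < d" for k l
    using assms that sym_mats_index by (auto simp: psd_mats_def)
  then show "round_mat d m X \<in> sym_mats d"
    by (intro sym_matsI) (auto simp: round_mat_def)
  show "\<bar>round_mat d m X $$ (k, l) - (real m \<cdot>\<^sub>m X) $$ (k, l) - (if k = l then real d + 1 else 0)\<bar> \<le> 1"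
    if "k < d" "l < d" for k l
    using X that floor_correct[of "real m * X $$ (k, l)"] by (simp add: round_mat_def) linarith
qed simp

lemma trace_round_mat:
  assumes "X \<in> psd_mats d" "1 \<le> d"
  obtains t :: int where "mat_trace (round_mat d m X) = of_int t" "1 \<le> t"
proof
  let ?t = "\<Sum>k<d. \<lfloor>real m * X $$ (k, k)\<rfloor> + (int d + 1)"
  show "mat_trace (round_mat d m X) = of_int ?t" by (simp add: mat_trace_def round_mat_def)
  \<comment> \<open>The diagonal of a psd matrix is nonnegative, hence so are the floors, and each
    summand is at least \<open>d + 1\<close>.\<close>
  have "(\<Sum>k<d. 1) \<le> ?t"
    by (intro sum_mono) (use psd_mats_diag_nonneg[OF assms(1)] in auto)
  then show "1 \<le> ?t" using assms(2) by simp
qed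

lemma round_mat_tendsto:
  assumes "k < d" "l < d"
  shows "(\<lambda>m. round_mat d m X $$ (k, l) / real m) \<longlonglongrightarrow> X $$ (k, l)"
proof (rule LIM_zero_cancel, rule metric_tendsto_imp_tendsto)
  \<comment> \<open>The constant \<open>d + 2\<close> is 1 for the floor plus \<open>d + 1\<close>
    for the diagonal shift.\<close>
  have "\<bar>round_mat d m X $$ (k, l) / real m - X $$ (k, l)\<bar> \<le> (real d + 2) / real m" if "m > 0" for m
  proof -
    have "\<bar>round_mat d m X $$ (k, l) - real m * X $$ (k, l)\<bar> \<le> real d + 2"
      using assms floor_correct[of "real m * X $$ (k, l)"] by (simp add: round_mat_def) linarith
    moreover have "round_mat d m X $$ (k, l) / real m - X $$ (k, l) =
        (round_mat d m X $$ (k, l) - real m * X $$ (k, l)) / real m"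
      using that by (simp add: field_simps)
    ultimately show ?thesis by (simp add: abs_divide divide_right_mono)
  qed
  then show "\<forall>\<^sub>F m in sequentially.
      dist (round_mat d m X $$ (k, l) / real m - X $$ (k, l)) 0 \<le> dist ((real d + 2) / real m) 0"
    by (intro eventually_sequentiallyI[of 1]) simp
  show "(\<lambda>m. (real d + 2) / real m) \<longlonglongrightarrow> 0" by (rule lim_const_over_n)
qed

lemma gram_form_round_tendsto:
  assumes "set Xs \<subseteq> carrier_mat d d"
  shows "(\<lambda>m. gram_form M (map (round_mat d m) Xs) / (real m)\<^sup>2) \<longlonglongrightarrow> gram_form M Xs"
proof -
  have c: "Xs ! i \<in> carrier_mat d d" if "i < length Xs" for i
    using assms nth_mem[OF that] by blast
  \<comment> \<open>One factor \<open>1 / m\<close> goes to each of the two matrices, leaving a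
    polynomial in convergent entries. The identity includes \<open>m = 0\<close>, where both sides
    are 0 because division by zero gives 0.\<close>
  have "gram_form M (map (round_mat d m) Xs) / (real m)\<^sup>2 =
     (\<Sum>i<length Xs. \<Sum>j<length Xs. M $$ (i, j) * (\<Sum>k<d. \<Sum>l<d.
        (round_mat d m (Xs ! i) $$ (k, l) / real m) * (round_mat d m (Xs ! j) $$ (l, k) / real m)))" for m
    by (simp add: gram_form_def mat_inner_sum[where d = d and e = d] sum_divide_distrib
        power2_eq_square flip: times_divide_eq_right)
  moreover have "gram_form M Xs = (\<Sum>i<length Xs. \<Sum>j<length Xs. M $$ (i, j) * (\<Sum>k<d. \<Sum>l<d.
        Xs ! i $$ (k, l) * Xs ! j $$ (l, k)))"
    unfolding gram_form_def
    by (intro sum.cong refl) (simp add: c mat_inner_sum[where d = d and e = d])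
  ultimately show ?thesis
    by (simp only:) (rule tendsto_sum, rule tendsto_sum, rule tendsto_mult[OF tendsto_const],
        rule tendsto_sum, rule tendsto_sum, rule tendsto_mult; rule round_mat_tendsto; simp)
qed

text \<open>The index \<open>r\<close> at which \<open>M\<close> is tested is the total trace of the
  rounded tuple. It varies with \<open>Xs\<close> and \<open>m\<close>, so membership is assumed for
  all \<open>r\<close>.\<close>

lemma gram_form_round_nonneg:
  assumes M: "\<And>r. 1 \<le> r \<Longrightarrow> M \<in> D_cone n r" and "1 \<le> n" "1 \<le> d"
    and Xs: "length Xs = n" "set Xs \<subseteq> psd_mats d"
  shows "0 \<le> gram_form M (map (round_mat d m) Xs)"
proof -
  let ?Zs = "map (round_mat d m) Xs"
  have psd: "Xs ! i \<in> psd_mats d" if "i < n" for i using Xs that nth_mem by blast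
  \<comment> \<open>The trace is already an integer; the floor only names it as an
    \<open>int\<close>, uniformly in \<open>i\<close>.\<close>
  define t where "t i = \<lfloor>mat_trace (round_mat d m (Xs ! i))\<rfloor>" for i
  have t: "mat_trace (round_mat d m (Xs ! i)) = of_int (t i)" "1 \<le> t i" if "i < n" for i
    by (rule trace_round_mat[OF psd[OF that] \<open>1 \<le> d\<close>, of m]; simp add: t_def)+
  define s where "s = (\<Sum>i<n. t i)"
  have "(\<Sum>i<n. 1) \<le> s" unfolding s_def by (intro sum_mono) (use t in auto)
  then have s: "1 \<le> s" using \<open>1 \<le> n\<close> by simp
  let ?Ys = "map ((\<cdot>\<^sub>m) (1 / of_int s)) ?Zs"
  have "set ?Ys \<subseteq> psd_mats d" using Xs s by (auto intro!: psd_mats_smult round_mat_psd)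
  moreover have "mat_trace (?Ys ! i) = of_int (t i) / of_int s" if "i < n" for i
    using t(1)[OF that] that Xs by (simp add: mat_trace_def round_mat_def flip: sum_divide_distrib)
  then have "(\<Sum>i<n. mat_trace (?Ys ! i)) = 1"
    using s by (simp add: s_def flip: sum_divide_distrib of_int_sum)
  moreover have "rat_denom_le (nat s) (Y $$ (k, l))"
    if Y_in: "Y \<in> set ?Ys" and kl: "k < dim_row Y" "l < dim_col Y" for Y k l
  proof -
    obtain X where Y: "Y = (1 / of_int s) \<cdot>\<^sub>m round_mat d m X"
      using Y_in unfolding set_map by blast
    \<comment> \<open>An integer over the common denominator \<open>s\<close>;
      \<open>rat_denom_le\<close> does not ask for lowest terms.\<close>
    then have "Y $$ (k, l) = of_int (\<lfloor>real m * X $$ (k, l)\<rfloor> + (if k = l then int d + 1 else 0)) / of_int s"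
      using kl by (simp add: round_mat_def)
    moreover have "1 \<le> s" "s \<le> int (nat s)" using s by auto
    ultimately show ?thesis unfolding rat_denom_le_def by blast
  qed
  ultimately have "?Ys \<in> Delta_rat n (nat s)"
    using Xs \<open>1 \<le> d\<close> by (auto simp: Delta_rat_def Delta_def)
  then have "0 \<le> mat_trace (p_eval M ?Ys)"
    using M[of "nat s"] s by (auto simp: D_cone_def)
  also have "\<dots> = gram_form M ?Ys"
    using Xs \<open>1 \<le> n\<close> \<open>1 \<le> d\<close> by (intro trace_p_eval[where d = d]) auto
  \<comment> \<open>Homogeneity of degree 2 undoes the normalization, and the factor is
    positive.\<close>
  also have "\<dots> = (1 / of_int s)\<^sup>2 * gram_form M ?Zs"
    by (rule gram_form_smult[where d = d]) auto
  finally show ?thesis using s by (simp add: zero_le_mult_iff)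
qed

theorem theorem2p9:
  fixes n :: nat
  assumes "n \<ge> 1"
  shows "dual_cone n (cs_plus n) = (\<Inter>r\<in>{1..}. D_cone n r)"
proof (intro subset_antisym subsetI)
  fix M assume "M \<in> dual_cone n (cs_plus n)"
  then have nonneg: "\<forall>d\<ge>1. \<forall>Xs. length Xs = n \<longrightarrow> set Xs \<subseteq> psd_mats d \<longrightarrow> 0 \<le> gram_form M Xs"
    unfolding dual_cone_cs_plus_iff by (rule conjunct2)
  \<comment> \<open>Nonnegativity on all of \<open>Delta n\<close>, rational or not, gives every
    \<open>D_cone n r\<close> at once.\<close>
  have "0 \<le> mat_trace (p_eval M Xs)" if Xs: "Xs \<in> Delta n" for Xs
  proof -
    obtain d where d: "1 \<le> d" "length Xs = n" "set Xs \<subseteq> psd_mats d"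
      using Xs unfolding Delta_def by blast
    then have "mat_trace (p_eval M Xs) = gram_form M Xs"
      using psd_mats_carrier[of d] assms by (intro trace_p_eval[where d = d]) auto
    then show ?thesis using nonneg d by simp
  qed
  then show "M \<in> (\<Inter>r\<in>{1..}. D_cone n r)"
    using \<open>M \<in> dual_cone n (cs_plus n)\<close> by (auto simp: D_cone_def Delta_rat_def dual_cone_def)
next
  fix M assume M: "M \<in> (\<Inter>r\<in>{1..}. D_cone n r)"
  have "0 \<le> gram_form M Xs" if "1 \<le> d" "length Xs = n" "set Xs \<subseteq> psd_mats d" for d Xs
  proof (rule LIMSEQ_le_const)
    show "(\<lambda>m. gram_form M (map (round_mat d m) Xs) / (real m)\<^sup>2) \<longlonglongrightarrow> gram_form M Xs"
      using that psd_mats_carrier[of d] by (intro gram_form_round_tendsto) simp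
    \<comment> \<open>Each \<open>m\<close> is handled at its own \<open>r\<close>; the limit then
      removes the rounding.\<close>
    have "0 \<le> gram_form M (map (round_mat d m) Xs)" for m
      using M assms that by (intro gram_form_round_nonneg[where n = n]) auto
    then show "\<exists>N. \<forall>m\<ge>N. 0 \<le> gram_form M (map (round_mat d m) Xs) / (real m)\<^sup>2"
      by simp
  qed
  moreover have "M \<in> sym_mats n" using M by (auto simp: D_cone_def)
  ultimately show "M \<in> dual_cone n (cs_plus n)" unfolding dual_cone_cs_plus_iff by blast
qed

end
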